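(* For every right-angled Artin group (respectively, every right-angled Coxeter group) $G$, with respect to the Artin (respectively, Coxeter) generators $X$, a word $w\in X^*$ is a conjugacy geodesic if and only if every cyclic permutation of $w$ is geodesic; that is, $\mathsf{ConjGeo}(G,X)=\mathsf{CycGeo}(G,X)$.
   Context: Groups are finitely generated and $X$ is taken to be inverse-closed (so in the Artin case $X$ consists of the standard Artin generators and their inverses). For $w\in X^*$, $l(w)$ is its length and $\pi(w)$ the element of $G$ it represents; $|g|$ is the length of a shortest word over $X$ representing $g$, and $|g|_c=\min\{|h| : h\text{ conjugate to } g\text{ in }G\}$. A word $w$ is geodesic if $l(w)=|\pi(w)|$, and a conjugacy geodesic if $l(w)=|\pi(w)|_c$. $\mathsf{ConjGeo}(G,X)$ is the set of conjugacy geodesics and $\mathsf{CycGeo}(G,X)$ is the set of words all of whose cyclic permutations are geodesic. *)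

theory Defs
  imports "HOL-Algebra.Group"
begin

subsection \<open>Words and lengths in a group with respect to a generating set\<close>

text \<open>
  Words are lists over a set \<open>X \<subseteq> carrier G\<close>, which is meant to generate \<open>G\<close> and to be closed
  under inversion. The lengths below carry no meaning for elements that are not represented by any
  word over \<open>X\<close>.
\<close>

definition word_val :: "('g, 'm) monoid_scheme \<Rightarrow> 'g list \<Rightarrow> 'g" where
  "word_val G w = foldr (mult G) w (one G)"

definition elt_length :: "('g, 'm) monoid_scheme \<Rightarrow> 'g set \<Rightarrow> 'g \<Rightarrow> nat" where
  "elt_length G X g = (LEAST n. \<exists>w \<in> lists X. word_val G w = g \<and> length w = n)"

definition conjugate_in :: "('g, 'm) monoid_scheme \<Rightarrow> 'g \<Rightarrow> 'g \<Rightarrow> bool" where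
  "conjugate_in G g h \<longleftrightarrow> (\<exists>x \<in> carrier G. h = x \<otimes>\<^bsub>G\<^esub> g \<otimes>\<^bsub>G\<^esub> inv\<^bsub>G\<^esub> x)"

definition conj_length :: "('g, 'm) monoid_scheme \<Rightarrow> 'g set \<Rightarrow> 'g \<Rightarrow> nat" where
  "conj_length G X g = (LEAST n. \<exists>h. conjugate_in G g h \<and> elt_length G X h = n)"

definition geodesic :: "('g, 'm) monoid_scheme \<Rightarrow> 'g set \<Rightarrow> 'g list \<Rightarrow> bool" where
  "geodesic G X w \<longleftrightarrow> w \<in> lists X \<and> length w = elt_length G X (word_val G w)"

definition conj_geodesic :: "('g, 'm) monoid_scheme \<Rightarrow> 'g set \<Rightarrow> 'g list \<Rightarrow> bool" where
  "conj_geodesic G X w \<longleftrightarrow> w \<in> lists X \<and> length w = conj_length G X (word_val G w)"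

definition ConjGeo :: "('g, 'm) monoid_scheme \<Rightarrow> 'g set \<Rightarrow> 'g list set" where
  "ConjGeo G X = {w \<in> lists X. conj_geodesic G X w}"

definition CycGeo :: "('g, 'm) monoid_scheme \<Rightarrow> 'g set \<Rightarrow> 'g list set" where
  "CycGeo G X = {w \<in> lists X. \<forall>n. geodesic G X (rotate n w)}"


subsection \<open>Group presentations\<close>

text \<open>
  The letter \<open>(s, True)\<close> stands for the generator \<open>s\<close> and \<open>(s, False)\<close> for its formal inverse.
  The group presented by \<open>S\<close> and relators \<open>R\<close> is the monoid of words in these letters modulo the
  congruence generated by free cancellation and by deletion of relators.
\<close>

type_synonym 's sword = "('s \<times> bool) list"

abbreviation swords :: "'s set \<Rightarrow> 's sword set" where
  "swords S \<equiv> lists (S \<times> UNIV)"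

inductive_set pres_rel :: "'s set \<Rightarrow> 's sword set \<Rightarrow> 's sword rel"
  for S :: "'s set" and R :: "'s sword set" where
  refl: "w \<in> swords S \<Longrightarrow> (w, w) \<in> pres_rel S R"
| sym: "(u, v) \<in> pres_rel S R \<Longrightarrow> (v, u) \<in> pres_rel S R"
| trans: "(u, v) \<in> pres_rel S R \<Longrightarrow> (v, w) \<in> pres_rel S R \<Longrightarrow> (u, w) \<in> pres_rel S R"
| cancel: "u \<in> swords S \<Longrightarrow> v \<in> swords S \<Longrightarrow> s \<in> S \<Longrightarrow>
    (u @ [(s, b), (s, \<not> b)] @ v, u @ v) \<in> pres_rel S R"
| relator: "u \<in> swords S \<Longrightarrow> v \<in> swords S \<Longrightarrow> r \<in> R \<Longrightarrow> r \<in> swords S \<Longrightarrow>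
    (u @ r @ v, u @ v) \<in> pres_rel S R"

definition presented_group :: "'s set \<Rightarrow> 's sword set \<Rightarrow> 's sword set monoid" where
  "presented_group S R =
    \<lparr> carrier = swords S // pres_rel S R,
      mult = (\<lambda>P Q. \<Union>u \<in> P. \<Union>v \<in> Q. pres_rel S R `` {u @ v}),
      one = pres_rel S R `` {[]} \<rparr>"

definition pres_gen :: "'s set \<Rightarrow> 's sword set \<Rightarrow> 's \<Rightarrow> 's sword set" where
  "pres_gen S R s = pres_rel S R `` {[(s, True)]}"

text \<open>
  \<open>G\<close> has the presentation with generators \<open>S\<close> and relators \<open>R\<close>, where \<open>a s\<close> is the element of
  \<open>G\<close> that corresponds to the generator \<open>s\<close>.
\<close>

definition has_presentation ::
  "('g, 'm) monoid_scheme \<Rightarrow> 's set \<Rightarrow> 's sword set \<Rightarrow> ('s \<Rightarrow> 'g) \<Rightarrow> bool" where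
  "has_presentation G S R a \<longleftrightarrow>
    group G \<and> (\<exists>\<phi> \<in> iso (presented_group S R) G. \<forall>s \<in> S. \<phi> (pres_gen S R s) = a s)"


subsection \<open>Right-angled Artin and Coxeter groups\<close>

definition finite_simple_graph :: "'v set \<Rightarrow> 'v rel \<Rightarrow> bool" where
  "finite_simple_graph V E \<longleftrightarrow> finite V \<and> E \<subseteq> V \<times> V \<and> Relation.sym E \<and> irrefl E"

text \<open>Adjacent vertices commute.\<close>

definition commutators :: "'v rel \<Rightarrow> 'v sword set" where
  "commutators E = {[(u, True), (v, True), (u, False), (v, False)] | u v. (u, v) \<in> E}"

definition squares :: "'v set \<Rightarrow> 'v sword set" where
  "squares V = {[(v, True), (v, True)] | v. v \<in> V}"

definition right_angled_Artin ::
  "('g, 'm) monoid_scheme \<Rightarrow> 'v set \<Rightarrow> 'v rel \<Rightarrow> ('v \<Rightarrow> 'g) \<Rightarrow> bool" where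
  "right_angled_Artin G V E a \<longleftrightarrow>
    finite_simple_graph V E \<and> has_presentation G V (commutators E) a"

definition right_angled_Coxeter ::
  "('g, 'm) monoid_scheme \<Rightarrow> 'v set \<Rightarrow> 'v rel \<Rightarrow> ('v \<Rightarrow> 'g) \<Rightarrow> bool" where
  "right_angled_Coxeter G V E a \<longleftrightarrow>
    finite_simple_graph V E \<and> has_presentation G V (squares V \<union> commutators E) a"

definition Artin_generators ::
  "('g, 'm) monoid_scheme \<Rightarrow> 'v set \<Rightarrow> ('v \<Rightarrow> 'g) \<Rightarrow> 'g set" where
  "Artin_generators G V a = a ` V \<union> m_inv G ` a ` V"

text \<open>Coxeter generators are involutions, so this set is already closed under inversion.\<close>

definition Coxeter_generators :: "'v set \<Rightarrow> ('v \<Rightarrow> 'g) \<Rightarrow> 'g set" where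
  "Coxeter_generators V a = a ` V"


subsection \<open>The presented group is a group with the given presentation\<close>

lemma pres_rel_swords:
  "(u, v) \<in> pres_rel S R \<Longrightarrow> u \<in> swords S \<and> v \<in> swords S"
  by (induction rule: pres_rel.induct) auto

lemma equiv_pres_rel: "equiv (swords S) (pres_rel S R)"
proof (rule equivI)
  show "pres_rel S R \<subseteq> swords S \<times> swords S"
    using pres_rel_swords by fast
  show "refl_on (swords S) (pres_rel S R)"
    by (rule refl_onI) (rule pres_rel.refl)
  show "Relation.sym (pres_rel S R)"
    by (rule symI) (rule pres_rel.sym)
  show "Relation.trans (pres_rel S R)"
    by (rule transI) (rule pres_rel.trans)
qed

lemma pres_rel_context:
  assumes "(u, v) \<in> pres_rel S R" "x \<in> swords S" "y \<in> swords S"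
  shows "(x @ u @ y, x @ v @ y) \<in> pres_rel S R"
  using assms
proof (induction rule: pres_rel.induct)
  case (refl w)
  then have "x @ w @ y \<in> swords S" by simp
  then show ?case by (rule pres_rel.refl)
next
  case (sym u v)
  then show ?case by (blast intro: pres_rel.sym)
next
  case (trans u v w)
  then show ?case by (blast intro: pres_rel.trans)
next
  case (cancel u v s b)
  then show ?case using pres_rel.cancel[of "x @ u" S "v @ y" s b R] by simp
next
  case (relator u v r)
  then show ?case using pres_rel.relator[of "x @ u" S "v @ y" r R] by simp
qed

lemma pres_rel_append:
  assumes "(u, u') \<in> pres_rel S R" "(v, v') \<in> pres_rel S R"
  shows "(u @ v, u' @ v') \<in> pres_rel S R"
proof -
  have "(u @ v, u' @ v) \<in> pres_rel S R"
    using pres_rel_context[OF assms(1), of "[]" v] pres_rel_swords[OF assms(2)] by simp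
  moreover have "(u' @ v, u' @ v') \<in> pres_rel S R"
    using pres_rel_context[OF assms(2), of u' "[]"] pres_rel_swords[OF assms(1)] by simp
  ultimately show ?thesis by (rule pres_rel.trans)
qed

lemma pres_mult_class:
  assumes "u \<in> swords S" "v \<in> swords S"
  shows "pres_rel S R `` {u} \<otimes>\<^bsub>presented_group S R\<^esub> pres_rel S R `` {v} = pres_rel S R `` {u @ v}"
proof -
  have "congruent2 (pres_rel S R) (pres_rel S R) (\<lambda>u v. pres_rel S R `` {u @ v})"
    by (auto simp: congruent2_def intro!: equiv_class_eq[OF equiv_pres_rel] pres_rel_append)
  then show ?thesis
    using UN_equiv_class2[OF equiv_pres_rel equiv_pres_rel _ assms]
    by (simp add: presented_group_def)
qed

lemma pres_inverse_word:
  "u \<in> swords S \<Longrightarrow> (map (\<lambda>(s, b). (s, \<not> b)) (rev u) @ u, []) \<in> pres_rel S R"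
proof (induction u)
  case Nil
  then show ?case by (auto intro: pres_rel.refl)
next
  case (Cons x u)
  obtain s b where x: "x = (s, b)" by (cases x)
  let ?u = "map (\<lambda>(s, b). (s, \<not> b)) (rev u)"
  have "?u \<in> swords S" using Cons.prems by auto
  then have "(?u @ [(s, \<not> b), (s, b)] @ u, ?u @ u) \<in> pres_rel S R"
    using pres_rel.cancel[of ?u S u s "\<not> b" R] Cons.prems x by simp
  moreover have "(?u @ u, []) \<in> pres_rel S R" using Cons by simp
  ultimately show ?case using x by (auto intro: pres_rel.trans)
qed

theorem group_presented_group: "group (presented_group S R)"
proof (rule groupI)
  let ?G = "presented_group S R" and ?c = "\<lambda>u. pres_rel S R `` {u}"
  have car: "\<exists>u \<in> swords S. P = ?c u" if "P \<in> carrier ?G" for P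
    using that by (auto simp: presented_group_def quotient_def)
  have inc: "?c u \<in> carrier ?G" if "u \<in> swords S" for u
    using that by (simp add: presented_group_def quotientI)
  have one: "\<one>\<^bsub>?G\<^esub> = ?c []" by (simp add: presented_group_def)
  note m = pres_mult_class[of _ S _ R]
  show "\<one>\<^bsub>?G\<^esub> \<in> carrier ?G" using inc one by simp
  show "P \<otimes>\<^bsub>?G\<^esub> Q \<in> carrier ?G" if PQ: "P \<in> carrier ?G" "Q \<in> carrier ?G" for P Q
  proof -
    obtain u v where "u \<in> swords S" "P = ?c u" "v \<in> swords S" "Q = ?c v"
      using car[OF PQ(1)] car[OF PQ(2)] by blast
    then show ?thesis using m[of u v] inc[of "u @ v"] by simp
  qed
  show "P \<otimes>\<^bsub>?G\<^esub> Q \<otimes>\<^bsub>?G\<^esub> T = P \<otimes>\<^bsub>?G\<^esub> (Q \<otimes>\<^bsub>?G\<^esub> T)"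
    if PQT: "P \<in> carrier ?G" "Q \<in> carrier ?G" "T \<in> carrier ?G" for P Q T
  proof -
    obtain u v w where "u \<in> swords S" "P = ?c u" "v \<in> swords S" "Q = ?c v"
        "w \<in> swords S" "T = ?c w"
      using car[OF PQT(1)] car[OF PQT(2)] car[OF PQT(3)] by blast
    then show ?thesis using m[of u v] m[of "u @ v" w] m[of v w] m[of u "v @ w"] by simp
  qed
  show "\<one>\<^bsub>?G\<^esub> \<otimes>\<^bsub>?G\<^esub> P = P" if "P \<in> carrier ?G" for P
    using car[OF that] m[of "[]"] one by auto
  show "\<exists>Q \<in> carrier ?G. Q \<otimes>\<^bsub>?G\<^esub> P = \<one>\<^bsub>?G\<^esub>" if P: "P \<in> carrier ?G" for P
  proof -
    obtain u where u: "u \<in> swords S" "P = ?c u" using car[OF P] by blast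
    let ?v = "map (\<lambda>(s, b). (s, \<not> b)) (rev u)"
    have v: "?v \<in> swords S" using u by auto
    have "?c ?v \<otimes>\<^bsub>?G\<^esub> P = ?c (?v @ u)" using m[OF v u(1)] u(2) by simp
    also have "\<dots> = ?c []"
      by (rule equiv_class_eq[OF equiv_pres_rel pres_inverse_word[OF u(1)]])
    finally show ?thesis using inc[OF v] one by auto
  qed
qed

lemma has_presentation_presented_group:
  "has_presentation (presented_group S R) S R (pres_gen S R)"
proof -
  have "id \<in> iso (presented_group S R) (presented_group S R)"
    by (simp add: iso_def hom_def)
  then show ?thesis
    unfolding has_presentation_def using group_presented_group by (metis id_apply)
qed

end

theory Submission
  imports Defs
begin

text \<open>
  Rewrite words up to rotation and swaps of adjacent commuting letters by deleting a letter and its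
  inverse when, cyclically, all letters between them commute with them. This relation has the
  diamond property, and the equivalence relation that it generates contains conjugacy in the group.
  Hence a word without such a pair is shortest among all words representing a conjugate. If a word
  does have such a pair, then one of its rotations contains the pair without wrapping around, and
  that rotation is not geodesic.
\<close>

subsection \<open>Cyclic words in commuting letters\<close>

text \<open>Rotation is what turns conjugacy into rewriting: conjugating by \<open>C\<close> puts
  \<open>C\<close> and its inverse at the two ends of a word, where they are cyclic neighbours and
  cancel. The obstacle is that a list has a cut point and may repeat letters, so the diamond closes
  only up to rotations and swaps, and only once a move is known to carry a possible deletion to a
  possible deletion. The critical overlap is a letter with an inverse on either side: the two
  deletions leave the surviving copy at different places, and it has to slide through both arcs.
  Artin and Coxeter groups share one abstract alphabet with an involution \<open>bar\<close>; a
  Coxeter generator equals its inverse, so its sign must be dropped before cancellation is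
  described. The rewriting serves the inclusion of \<open>CycGeo\<close> in \<open>ConjGeo\<close>;
  the other inclusion comes from rotations being conjugate.\<close>

lemma filter_rotate: "\<exists>m. filter P (rotate n xs) = rotate m (filter P xs)"
proof -
  let ?k = "n mod length xs"
  have "filter P xs = filter P (take ?k xs) @ filter P (drop ?k xs)"
    by (metis append_take_drop_id filter_append)
  then show ?thesis
    by (metis filter_append rotate_append rotate_drop_take)
qed

lemma rotate_commute_ex: "rotate n xs = us @ vs \<Longrightarrow> \<exists>m. rotate m xs = vs @ us"
  by (metis rotate_append rotate_rotate)

text \<open>The starting entry fixes the offset modulo the length. This lets two cancelling pairs be
  compared inside one list once both are read from a common position.\<close>

lemma distinct_rotate_tl_unique:
  assumes "distinct xs" "rotate n xs = x # us" "rotate m xs = x # vs"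
  shows "us = vs"
proof -
  have "xs \<noteq> []" using assms by auto
  then have "xs ! (n mod length xs) = x" "xs ! (m mod length xs) = x"
    using hd_rotate_conv_nth[of xs n] hd_rotate_conv_nth[of xs m] assms by auto
  then have "n mod length xs = m mod length xs"
    using nth_eq_iff_index_eq[OF assms(1)] \<open>xs \<noteq> []\<close> by (metis length_greater_0_conv mod_less_divisor)
  then show ?thesis using assms rotate_conv_mod by (metis list.inject)
qed

lemma append_Cons_eq_append_Cons_cases:
  assumes "us @ x # vs = ws @ y # zs"
  obtains "x = y" | r where "ws = us @ x # r" "vs = r @ y # zs"
    | r where "us = ws @ y # r" "zs = r @ x # vs"
  using assms[unfolded append_eq_append_conv2]
proof (elim exE disjE conjE)
  fix r assume "us = ws @ r" "r @ x # vs = y # zs"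
  then show thesis using that(1) that(3)[of "tl r"] by (cases r) auto
next
  fix r assume "us @ r = ws" "x # vs = r @ y # zs"
  then show thesis using that(1) that(2)[of "tl r"] by (cases r) auto
qed

text \<open>\<open>bar\<close> may have fixed points, which is the Coxeter case.
  \<open>I_bar\<close> and \<open>I_irrefl\<close> together exclude \<open>I x (bar x)\<close>: a
  letter and its inverse count as dependent although they commute in the group, so a swap never
  exchanges the two letters of a cancelling pair.\<close>

locale commuting_letters =
  fixes bar :: "'l \<Rightarrow> 'l" and I :: "'l \<Rightarrow> 'l \<Rightarrow> bool"
  assumes bar_bar [simp]: "bar (bar x) = x"
    and I_sym: "I x y \<Longrightarrow> I y x"
    and I_irrefl [simp]: "\<not> I x x"
    and I_bar: "I x y \<Longrightarrow> I (bar x) y"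
begin

lemma I_bar_iff [simp]: "I (bar x) y \<longleftrightarrow> I x y" "I x (bar y) \<longleftrightarrow> I x y"
  by (metis I_bar bar_bar) (metis I_bar I_sym bar_bar)

section \<open>Cyclic words: rotation, swaps and deletion of a cancelling pair\<close>

inductive cyc_move :: "'l list \<Rightarrow> 'l list \<Rightarrow> bool" where
  rot: "cyc_move (u @ v) (v @ u)"
| swap: "I x y \<Longrightarrow> cyc_move (u @ x # y # v) (u @ y # x # v)"

abbreviation cyc_eq :: "'l list \<Rightarrow> 'l list \<Rightarrow> bool" (infix "\<approx>" 50) where
  "u \<approx> v \<equiv> cyc_move\<^sup>*\<^sup>* u v"

lemma cyc_eq_sym: "u \<approx> v \<Longrightarrow> v \<approx> u"
proof (induction rule: rtranclp_induct)
  case (step v w)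
  have "cyc_move w v" using step.hyps(2) by cases (auto intro: rot swap I_sym)
  then show ?case using step.IH by (rule converse_rtranclp_into_rtranclp)
qed simp

lemma cyc_eq_length: "u \<approx> v \<Longrightarrow> length u = length v"
  by (induction rule: rtranclp_induct) (auto elim!: cyc_move.cases)

lemma cyc_eq_rotate: "w \<approx> rotate n w"
  using rot[of "take (n mod length w) w" "drop (n mod length w) w"]
  by (auto simp: rotate_drop_take)

lemma cyc_eq_move_letter: "\<forall>y\<in>set u. I x y \<Longrightarrow> p @ x # u @ q \<approx> p @ u @ x # q"
proof (induction u arbitrary: p)
  case (Cons y u)
  have "p @ x # (y # u) @ q \<approx> p @ y # x # u @ q"
    using Cons.prems swap[of x y p "u @ q"] by auto
  also have "\<dots> \<approx> p @ y # u @ x # q"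
    using Cons.IH[of "p @ [y]"] Cons.prems by simp
  finally show ?case by simp
qed simp

text \<open>The rotation brings the pair's first letter to the front, so only the arc
  \<open>u\<close> is constrained and \<open>v\<close> is arbitrary. Since \<open>u @ v\<close> is
  just one list for the resulting cyclic word, later statements compare results up to
  \<open>\<approx>\<close>.\<close>

definition reduces :: "'l list \<Rightarrow> 'l list \<Rightarrow> bool" where
  "reduces w w' \<longleftrightarrow>
    (\<exists>n x u v. rotate n w = x # u @ bar x # v \<and> (\<forall>y\<in>set u. I x y) \<and> w' = u @ v)"

lemma reduces_length: "reduces w w' \<Longrightarrow> length w' < length w"
  unfolding reduces_def by (metis (no_types, lifting) length_append length_rotate add_Suc_right length_Cons less_Suc_eq)

lemma reducesI_rotation:
  assumes "p @ q = x # u @ bar x # v" "\<forall>y\<in>set u. I x y"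
  shows "reduces (q @ p) (u @ v)"
  using assms unfolding reduces_def by (metis rotate_append)

lemma reduces_rotate: "reduces (rotate n w) w' \<Longrightarrow> reduces w w'"
  unfolding reduces_def by (metis rotate_rotate)

lemma reduces_append_commute: "reduces (p @ q) w \<Longrightarrow> reduces (q @ p) w"
  using reduces_rotate[of "length q" "q @ p" w] by (simp add: rotate_append)

text \<open>A swap inside the arc or outside it leaves the pair cancelling. A swap that involves an
  end of the pair moves the other letter into or out of the arc, and \<open>I a b\<close> is exactly
  the commutation that the new arc requires.\<close>

lemma swap_cases:
  assumes "I a b" and "\<forall>y\<in>set u. I x y" and "x # u @ bar x # v = p @ a # b # q"
  shows "\<exists>w. reduces (p @ b # a # q) w \<and> u @ v \<approx> w"
proof (cases p)
  case Nil
  then have [simp]: "x = a" and eq: "u @ bar a # v = b # q" using assms(3) by auto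
  show ?thesis
  proof (cases u)
    case Nil
    \<comment> \<open>Impossible: \<open>b\<close> would be \<open>bar a\<close>, which
      \<open>I a b\<close> forbids.\<close>
    then show ?thesis using eq assms(1) by auto
  next
    case (Cons c u')
    then have [simp]: "c = b" "u = b # u'" "q = u' @ bar a # v" using eq by auto
    \<comment> \<open>The swap puts \<open>b\<close> before \<open>a\<close>, so cyclically it
      leaves the arc and joins the end of \<open>v\<close>.\<close>
    have "reduces ([b] @ (a # u' @ bar a # v)) (u' @ v @ [b])"
      using reducesI_rotation[of "a # u' @ bar a # v" "[b]" a u' "v @ [b]"] assms(2) by simp
    moreover have "u @ v \<approx> u' @ v @ [b]" using rot[of "[b]" "u' @ v"] by auto
    ultimately show ?thesis using \<open>p = []\<close> by auto
  qed
next
  case (Cons c p')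
  then have [simp]: "p = x # p'" and eq: "u @ bar x # v = p' @ a # b # q" using assms(3) by auto
  have red: "reduces (x # u' @ bar x # v') (u' @ v')" if "\<forall>y\<in>set u'. I x y" for u' v'
    using reducesI_rotation[of "x # u' @ bar x # v'" "[]"] that by simp
  consider r where "u = p' @ r" "r @ bar x # v = a # b # q"
    | r where "p' = u @ bar x # r" "v = r @ a # b # q"
    using eq[unfolded append_eq_append_conv2]
  proof (elim exE disjE conjE)
    fix r assume "u @ r = p'" "bar x # v = r @ a # b # q"
    then show thesis using that(1)[of "[]"] that(2)[of "tl r"] by (cases r) auto
  next
    fix r assume "u = p' @ r" "r @ bar x # v = a # b # q"
    then show thesis using that(1) by blast
  qed
  then show ?thesis
  proof cases
    case 2
    have "u @ v \<approx> u @ r @ b # a # q"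
      using swap[OF assms(1), of "u @ r" q] 2 by auto
    then show ?thesis using red[of u "r @ b # a # q"] 2 assms(2) by auto
  next
    case 1
    consider "r = []" "a = bar x" "v = b # q" | "r = [a]" "b = bar x" "v = q"
      | r' where "r = a # b # r'" "q = r' @ bar x # v"
      using 1(2) by (cases r; cases "tl r") auto
    then show ?thesis
    proof cases
      case 1
      \<comment> \<open>Here \<open>a\<close> is \<open>bar x\<close>, and \<open>b\<close> enters
        the arc.\<close>
      then show ?thesis using red[of "u @ [b]" q] \<open>u = p' @ r\<close> assms(1,2) by auto
    next
      case 2
      then show ?thesis using red[of p' "a # q"] \<open>u = p' @ r\<close> assms(1,2) by auto
    next
      case 3
      have "u @ v \<approx> p' @ b # a # r' @ v"
        using swap[OF assms(1), of p' "r' @ v"] \<open>u = p' @ r\<close> 3 by auto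
      then show ?thesis using red[of "p' @ b # a # r'" v] \<open>u = p' @ r\<close> 3 assms(2) by auto
    qed
  qed
qed

text \<open>The cut separates the swapped letters, so \<open>b\<close> is \<open>x\<close> itself.
  The swap moves \<open>a\<close> from the end of \<open>v\<close> to the start of the arc;
  \<open>v\<close> is nonempty because otherwise \<open>a\<close> would be
  \<open>bar b\<close>.\<close>

lemma wrapped_swap_cases:
  assumes "I a b" and "\<forall>y\<in>set u. I x y" and "x # u @ bar x # v = b # q @ [a]"
  shows "\<exists>w. reduces (a # q @ [b]) w \<and> u @ v \<approx> w"
proof -
  have eq: "x = b" "u @ bar x # v = q @ [a]" using assms(3) by auto
  have "v \<noteq> []"
  proof
    assume "v = []"
    then have "a = bar b" using eq by simp
    then show False using assms(1) by simp
  qed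
  then obtain v' c where "v = v' @ [c]" by (metis rev_exhaust)
  moreover from this have "(u @ bar x # v') @ [c] = q @ [a]" using eq(2) by simp
  ultimately have v: "v = v' @ [a]" "q = u @ bar x # v'" "b = x" using eq(1) by blast+
  have "reduces ((a # q) @ [b]) ((a # u) @ v')"
    using reducesI_rotation[of "[x]" "a # u @ bar x # v'" x "a # u" v'] v assms(2) I_sym[OF assms(1)] by auto
  moreover have "u @ v \<approx> (a # u) @ v'" using rot[of "u @ v'" "[a]"] v by auto
  ultimately show ?thesis by auto
qed

lemma rotate_two_cases:
  obtains p' q' where "rotate n (p @ a # b # q) = p' @ a # b # q'"
      "\<exists>m. rotate m (p @ b # a # q) = p' @ b # a # q'"
  | "rotate n (p @ a # b # q) = b # (q @ p) @ [a]"
proof -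
  obtain u v where uv: "p @ a # b # q = u @ v" "rotate n (p @ a # b # q) = v @ u"
    by (metis append_take_drop_id rotate_drop_take)
  consider r where "p = u @ r" "v = r @ a # b # q"
    | "u = p @ [a]" "v = b # q" | r where "u = p @ a # b # r" "q = r @ v"
    using uv(1)[unfolded append_eq_append_conv2]
  proof (elim exE disjE conjE)
    fix r assume "p @ r = u" "a # b # q = r @ v"
    then show thesis using that(1)[of "[]"] that(2) that(3)[of "tl (tl r)"]
      by (cases r; cases "tl r") auto
  next
    fix r assume "p = u @ r" "r @ a # b # q = v"
    then show thesis using that(1) by blast
  qed
  then show thesis
  proof cases
    case 1
    have "rotate (length u) (u @ r @ b # a # q) = (r @ b # a # q) @ u" by (rule rotate_append)
    then have "\<exists>m. rotate m (p @ b # a # q) = r @ b # a # q @ u" using 1 by auto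
    then show thesis using that(1)[of r "q @ u"] uv(2) 1 by simp
  next
    case 2
    then show thesis using that(2) uv(2) by simp
  next
    case 3
    have "\<exists>m. rotate m ((p @ b # a # r) @ v) = v @ (p @ b # a # r)"
      using rotate_append by blast
    then have "\<exists>m. rotate m (p @ b # a # q) = (v @ p) @ b # a # r" using 3 by simp
    then show thesis using that(1)[of "v @ p" r] uv(2) 3 by simp
  qed
qed

text \<open>This makes deletion meaningful for classes of \<open>\<approx>\<close>. The cut of the
  rotation either avoids the swapped letters, so that the swap happens inside the rotated word, or
  falls between them.\<close>

lemma reduces_cyc_move:
  assumes "cyc_move w z" "reduces w w'"
  shows "\<exists>z'. reduces z z' \<and> w' \<approx> z'"
  using assms(1)
proof cases
  case (rot u v)
  then show ?thesis using assms(2) reduces_append_commute by auto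
next
  case (swap a b p q)
  obtain n x u v where red: "rotate n w = x # u @ bar x # v" "\<forall>y\<in>set u. I x y" "w' = u @ v"
    using assms(2) unfolding reduces_def by blast
  show ?thesis
  proof (rule rotate_two_cases[of n p a b q])
    fix p' q'
    assume *: "rotate n (p @ a # b # q) = p' @ a # b # q'"
      "\<exists>m. rotate m (p @ b # a # q) = p' @ b # a # q'"
    have "x # u @ bar x # v = p' @ a # b # q'" using * red(1) swap(1) by simp
    then obtain z' where "reduces (p' @ b # a # q') z'" "u @ v \<approx> z'"
      using swap_cases[OF swap(3) red(2)] by blast
    then show ?thesis using *(2) reduces_rotate red(3) swap(2) by metis
  next
    assume *: "rotate n (p @ a # b # q) = b # (q @ p) @ [a]"
    have "x # u @ bar x # v = b # (q @ p) @ [a]" using * red(1) swap(1) by simp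
    then obtain z' where "reduces (a # (q @ p) @ [b]) z'" "u @ v \<approx> z'"
      using wrapped_swap_cases[OF swap(3) red(2)] by blast
    then show ?thesis
      using reduces_append_commute[of "a # q" "p @ [b]" z'] red swap by auto
  qed
qed

lemma reduces_cyc_eq:
  assumes "w \<approx> z" "reduces w w'"
  shows "\<exists>z'. reduces z z' \<and> w' \<approx> z'"
  using assms
proof (induction rule: rtranclp_induct)
  case (step y z)
  then show ?case by (metis reduces_cyc_move rtranclp_trans)
qed auto

section \<open>Local confluence through labelled positions\<close>

text \<open>
  A word is also a list of distinct positions with a labelling by letters. Erasing positions is
  filtering, so erasures of disjoint pairs of positions commute, which settles the diamond property
  except for overlapping pairs.
\<close>

definition cancels :: "('p \<Rightarrow> 'l) \<Rightarrow> 'p list \<Rightarrow> 'p \<Rightarrow> 'p \<Rightarrow> bool" where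
  "cancels lab p i j \<longleftrightarrow> (\<exists>n u v. rotate n p = i # u @ j # v \<and>
     lab j = bar (lab i) \<and> (\<forall>k\<in>set u. I (lab i) (lab k)))"

abbreviation erase :: "'p \<Rightarrow> 'p \<Rightarrow> 'p list \<Rightarrow> 'p list" where
  "erase i j \<equiv> filter (\<lambda>k. k \<notin> {i, j})"

text \<open>Distinctness of positions ensures that the filter drops exactly two entries; their
  letters may well recur in \<open>u\<close> or \<open>v\<close>.\<close>

lemma erase_cyc_eq:
  assumes "distinct p" "rotate n p = i # u @ j # v"
  shows "map lab (u @ v) \<approx> map lab (erase i j p)"
proof -
  have "distinct (i # u @ j # v)" using assms by (metis distinct_rotate)
  then have "erase i j (rotate n p) = u @ v"
    unfolding assms(2) by (auto simp: filter_id_conv intro!: arg_cong2[of _ _ _ _ append])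
  then obtain m where "u @ v = rotate m (erase i j p)" using filter_rotate by metis
  then show ?thesis using cyc_eq_sym[OF cyc_eq_rotate] by (metis rotate_map)
qed

lemma cancels_imp_reduces:
  assumes "distinct p" "cancels lab p i j"
  shows "\<exists>w. reduces (map lab p) w \<and> w \<approx> map lab (erase i j p)"
proof -
  obtain n u v where *: "rotate n p = i # u @ j # v" "lab j = bar (lab i)"
    "\<forall>k\<in>set u. I (lab i) (lab k)" using assms(2) unfolding cancels_def by blast
  have "reduces (map lab p) (map lab (u @ v))"
    unfolding reduces_def using * by (intro exI[of _ n] exI) (auto simp: rotate_map)
  then show ?thesis using erase_cyc_eq[OF assms(1) *(1)] by blast
qed

lemma reduces_imp_cancels:
  assumes "distinct p" "reduces (map lab p) w"
  shows "\<exists>i j. cancels lab p i j \<and> w \<approx> map lab (erase i j p)"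
proof -
  obtain n x u v where *: "rotate n (map lab p) = x # u @ bar x # v" "\<forall>y\<in>set u. I x y" "w = u @ v"
    using assms(2) unfolding reduces_def by blast
  then obtain i u' j v' where "rotate n p = i # u' @ j # v'" "lab i = x" "lab j = bar x"
    "u = map lab u'" "v = map lab v'"
    by (auto simp: rotate_map map_eq_Cons_conv map_eq_append_conv)
  then have "cancels lab p i j \<and> w \<approx> map lab (erase i j p)"
    using * erase_cyc_eq[OF assms(1), of n i u' j v' lab] unfolding cancels_def by auto
  then show ?thesis by blast
qed

text \<open>Erasing other positions can only thin out the arc, so its commutation condition
  survives.\<close>

lemma cancels_erase:
  assumes "cancels lab p k l" "k \<notin> {i, j}" "l \<notin> {i, j}"
  shows "cancels lab (erase i j p) k l"
proof -
  obtain n u v where *: "rotate n p = k # u @ l # v" "lab l = bar (lab k)"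
    "\<forall>m\<in>set u. I (lab k) (lab m)" using assms(1) unfolding cancels_def by blast
  obtain m where "rotate m (erase i j p) = erase i j (k # u @ l # v)"
    using filter_rotate *(1) by metis
  also have "\<dots> = k # erase i j u @ l # erase i j v" using assms by auto
  finally show ?thesis using *(2,3) unfolding cancels_def by fastforce
qed

text \<open>The only overlap in which the two results are not the same list of positions.\<close>

lemma cancels_chain:
  assumes "distinct p" "cancels lab p i j" "cancels lab p k i"
  shows "map lab (erase i j p) \<approx> map lab (erase k i p)"
proof (cases "j = k")
  case True
  then have "erase i j p = erase k i p" by (auto intro: filter_cong)
  then show ?thesis by simp
next
  case False
  obtain n u v where 1: "rotate n p = i # u @ j # v" "lab j = bar (lab i)"
    "\<forall>m\<in>set u. I (lab i) (lab m)" using assms(2) unfolding cancels_def by blast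
  obtain n' s t where 2: "rotate n' p = k # s @ i # t" "lab i = bar (lab k)"
    "\<forall>m\<in>set s. I (lab k) (lab m)" using assms(3) unfolding cancels_def by blast
  obtain m where "rotate m p = i # t @ k # s" using rotate_commute_ex[of n' p "k # s" "i # t"] 2 by auto
  then have eq: "u @ j # v = t @ k # s" using distinct_rotate_tl_unique[OF assms(1) 1(1)] by simp
  have lab: "lab k = lab j" "lab i = bar (lab k)" "lab i = bar (lab j)" using 1(2) 2(2) by auto
  \<comment> \<open>Both \<open>j\<close> and \<open>k\<close> carry the inverse of the letter at
    \<open>i\<close>, so neither fits into an arc. The cyclic order is therefore
    \<open>i, u, j, r, k, s\<close>.\<close>
  have "k \<notin> set u" using 1(3) lab(2) by (metis I_bar_iff(1) I_irrefl)
  moreover have "j \<notin> set s" using 2(3) lab(1) by (metis I_irrefl)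
  ultimately obtain r where r: "t = u @ j # r" "v = r @ k # s"
    using eq False by (auto elim: append_Cons_eq_append_Cons_cases)
  define y where "y = lab j"
  have y: "lab k = y" "lab j = y" using 1(2) 2(2) y_def by auto
  have yu: "\<forall>z\<in>set (map lab u). I y z" "\<forall>z\<in>set (map lab s). I y z" using 1 2 y by auto
  \<comment> \<open>One erasure keeps the letter \<open>y\<close> at \<open>k\<close>, the other
    keeps it at \<open>j\<close>. The copy at \<open>k\<close> slides through \<open>s\<close>, past
    the gap left by \<open>i\<close>, and through \<open>u\<close> to the place of
    \<open>j\<close>.\<close>
  let ?u = "map lab u" and ?r = "map lab r" and ?s = "map lab s"
  have "map lab (erase i j p) \<approx> ?u @ ?r @ y # ?s"
    using cyc_eq_sym[OF erase_cyc_eq[OF assms(1) 1(1), of lab]] r y by simp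
  also have "\<dots> \<approx> ?r @ y # ?s @ ?u" using rot[of ?u "?r @ y # ?s"] by auto
  also have "\<dots> \<approx> (?r @ ?s) @ y # ?u @ []"
    using cyc_eq_move_letter[OF yu(2), of ?r ?u] by simp
  also have "\<dots> \<approx> (?r @ ?s) @ ?u @ y # []"
    using cyc_eq_move_letter[OF yu(1)] by blast
  also have "\<dots> \<approx> ?u @ y # ?r @ ?s" using rot[of "?r @ ?s" "?u @ [y]"] by auto
  also have "\<dots> \<approx> ?s @ ?u @ y # ?r" using rot[of "?u @ y # ?r" "?s"] by auto
  also have "\<dots> \<approx> map lab (erase k i p)"
    using erase_cyc_eq[OF assms(1) 2(1), of lab] r y by simp
  finally show ?thesis .
qed

text \<open>A shared first or shared second position determines the partner: two different
  candidates would put one of them inside the other's arc, where a letter would have to be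
  independent of itself or of its inverse. The remaining overlaps are chains.\<close>

lemma cancels_overlap:
  assumes "distinct p" "cancels lab p i j" "cancels lab p k l" "{i, j} \<inter> {k, l} \<noteq> {}"
  shows "map lab (erase i j p) \<approx> map lab (erase k l p)"
proof -
  obtain n u v where 1: "rotate n p = i # u @ j # v" "lab j = bar (lab i)"
    "\<forall>m\<in>set u. I (lab i) (lab m)" using assms(2) unfolding cancels_def by blast
  obtain n' s t where 2: "rotate n' p = k # s @ l # t" "lab l = bar (lab k)"
    "\<forall>m\<in>set s. I (lab k) (lab m)" using assms(3) unfolding cancels_def by blast
  consider "i = k" | "j = l" | "i = l" | "j = k" using assms(4) by auto
  then show ?thesis
  proof cases
    assume "i = k"
    then have "u @ j # v = s @ l # t"
      using distinct_rotate_tl_unique[OF assms(1) 1(1)] 2(1) by blast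
    moreover have "lab l = bar (lab i)" "lab j = bar (lab k)" using 1(2) 2(2) \<open>i = k\<close> by auto
    then have "l \<notin> set u" "j \<notin> set s" using 1(3) 2(3) by (metis I_bar_iff(2) I_irrefl)+
    ultimately have "j = l" by (auto elim: append_Cons_eq_append_Cons_cases)
    then show ?thesis using \<open>i = k\<close> by simp
  next
    assume "j = l"
    obtain m m' where "rotate m p = j # v @ i # u" "rotate m' p = j # t @ k # s"
      using rotate_commute_ex[of n p "i # u" "j # v"] rotate_commute_ex[of n' p "k # s" "l # t"]
        1(1) 2(1) \<open>j = l\<close> by auto
    then have "v @ i # u = t @ k # s" using distinct_rotate_tl_unique[OF assms(1)] by blast
    moreover have "lab i = lab k" using 1(2) 2(2) \<open>j = l\<close> bar_bar by metis
    then have "i \<notin> set s" "k \<notin> set u" using 1(3) 2(3) by (metis I_irrefl)+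
    ultimately have "i = k" by (auto elim: append_Cons_eq_append_Cons_cases)
    then show ?thesis using \<open>j = l\<close> by simp
  next
    assume "i = l"
    then show ?thesis using cancels_chain[OF assms(1)] assms(2,3) by blast
  next
    assume "j = k"
    then show ?thesis using cancels_chain[OF assms(1)] assms(2,3) cyc_eq_sym by blast
  qed
qed

lemma reduces_diamond:
  assumes "reduces w a" "reduces w b"
  shows "a \<approx> b \<or> (\<exists>c d. reduces a c \<and> reduces b d \<and> c \<approx> d)"
proof -
  \<comment> \<open>Indices serve as positions, which tells equal letters apart.\<close>
  define p where "p = [0..<length w]"
  have p: "distinct p" "map ((!) w) p = w" unfolding p_def by (simp_all add: map_nth)
  obtain i j where ij: "cancels ((!) w) p i j" "a \<approx> map ((!) w) (erase i j p)"
    using reduces_imp_cancels[OF p(1), of "(!) w" a] assms(1) p(2) by auto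
  obtain k l where kl: "cancels ((!) w) p k l" "b \<approx> map ((!) w) (erase k l p)"
    using reduces_imp_cancels[OF p(1), of "(!) w" b] assms(2) p(2) by auto
  show ?thesis
  proof (cases "{i, j} \<inter> {k, l} = {}")
    case False
    then show ?thesis
      using rtranclp_trans[OF rtranclp_trans[OF ij(2) cancels_overlap[OF p(1) ij(1) kl(1)]] cyc_eq_sym[OF kl(2)]]
      by blast
  next
    case True
    have comm: "erase i j (erase k l p) = erase k l (erase i j p)"
      by (simp add: conj_ac)
    obtain c' where c': "reduces (map ((!) w) (erase i j p)) c'"
        "c' \<approx> map ((!) w) (erase k l (erase i j p))"
      using cancels_imp_reduces[OF distinct_filter[OF p(1)] cancels_erase[OF kl(1), of i j]] True
      by blast
    obtain d' where d': "reduces (map ((!) w) (erase k l p)) d'"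
        "d' \<approx> map ((!) w) (erase i j (erase k l p))"
      using cancels_imp_reduces[OF distinct_filter[OF p(1)] cancels_erase[OF ij(1), of k l]] True
      by blast
    \<comment> \<open>The erased lists agree with \<open>a\<close> and \<open>b\<close> only up to
      \<open>\<approx>\<close>, so the deletions are carried over to \<open>a\<close> and
      \<open>b\<close>.\<close>
    obtain c where c: "reduces a c" "c' \<approx> c"
      using reduces_cyc_eq[OF cyc_eq_sym[OF ij(2)] c'(1)] by blast
    obtain d where d: "reduces b d" "d' \<approx> d"
      using reduces_cyc_eq[OF cyc_eq_sym[OF kl(2)] d'(1)] by blast
    have "c \<approx> c'" by (rule cyc_eq_sym[OF c(2)])
    also have "\<dots> \<approx> d'" using c'(2) cyc_eq_sym[OF d'(2)] comm by simp
    also have "\<dots> \<approx> d" by (rule d(2))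
    finally show ?thesis using c(1) d(1) by blast
  qed
qed

section \<open>Confluence and minimal length\<close>

definition cyc_reduces :: "'l list \<Rightarrow> 'l list \<Rightarrow> bool" (infix "\<leadsto>" 50) where
  "w \<leadsto> z \<longleftrightarrow> w \<approx> z \<or> (\<exists>w'. reduces w w' \<and> w' \<approx> z)"

text \<open>Since \<open>\<leadsto>\<close> allows zero deletions, every local divergence closes
  with one step on each side. Confluence then follows by tiling, with no termination
  argument.\<close>

lemma cyc_reduces_diamond:
  assumes "w \<leadsto> a" "w \<leadsto> b"
  shows "\<exists>c. a \<leadsto> c \<and> b \<leadsto> c"
proof -
  have *: "\<exists>c. a \<leadsto> c \<and> b \<leadsto> c" if "w \<approx> a" "w \<leadsto> b" for a b
  proof -
    have "a \<leadsto> b"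
      using that reduces_cyc_eq cyc_eq_sym unfolding cyc_reduces_def by (metis rtranclp_trans)
    then show ?thesis unfolding cyc_reduces_def by blast
  qed
  show ?thesis
  proof (cases "w \<approx> a \<or> w \<approx> b")
    case True
    then show ?thesis using * assms by blast
  next
    case False
    then obtain a' b' where a: "reduces w a'" "a' \<approx> a" and b: "reduces w b'" "b' \<approx> b"
      using assms unfolding cyc_reduces_def by blast
    from reduces_diamond[OF a(1) b(1)] show ?thesis
    proof (elim disjE exE conjE)
      assume "a' \<approx> b'"
      then have "a \<approx> b" using a b cyc_eq_sym by (meson rtranclp_trans)
      then show ?thesis unfolding cyc_reduces_def by blast
    next
      fix c d assume "reduces a' c" "reduces b' d" "c \<approx> d"
      then obtain c' d' where "reduces a c'" "c \<approx> c'" "reduces b d'" "d \<approx> d'"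
        using reduces_cyc_eq a(2) b(2) by meson
      moreover from this have "d' \<approx> c'" using \<open>c \<approx> d\<close> cyc_eq_sym by (meson rtranclp_trans)
      ultimately show ?thesis unfolding cyc_reduces_def by blast
    qed
  qed
qed

lemma cyc_reduces_strip:
  assumes "cyc_reduces\<^sup>*\<^sup>* w a" "w \<leadsto> b"
  shows "\<exists>c. a \<leadsto> c \<and> cyc_reduces\<^sup>*\<^sup>* b c"
  using assms
proof (induction rule: rtranclp_induct)
  case (step y z)
  then show ?case by (meson cyc_reduces_diamond rtranclp.rtrancl_into_rtrancl)
qed blast

abbreviation conj_eq :: "'l list \<Rightarrow> 'l list \<Rightarrow> bool" (infix "\<simeq>" 50) where
  "conj_eq \<equiv> equivclp cyc_reduces"

text \<open>Church-Rosser: every word equivalent to \<open>w\<close> rewrites to \<open>w\<close>,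
  and no step increases the length.\<close>

lemma irreducible_shortest:
  assumes "\<And>w'. \<not> reduces w w'" and "w \<simeq> v"
  shows "length w \<le> length v"
proof -
  from assms(2) have "cyc_reduces\<^sup>*\<^sup>* v w"
  proof (induction rule: equivclp_induct)
    case (step y z)
    from step.hyps(2) show ?case
    proof
      assume "y \<leadsto> z"
      then obtain c where "w \<leadsto> c" "cyc_reduces\<^sup>*\<^sup>* z c" using cyc_reduces_strip step.IH by blast
      \<comment> \<open>An irreducible \<open>w\<close> can only make moves, and these are
        reversible.\<close>
      moreover from this have "c \<leadsto> w"
        using assms(1) cyc_eq_sym unfolding cyc_reduces_def by blast
      ultimately show ?thesis by simp
    next
      assume "z \<leadsto> y"
      then show ?thesis using step.IH by simp
    qed
  qed simp
  then show ?thesis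
  proof (induction rule: rtranclp_induct)
    case (step y z)
    then show ?case using cyc_eq_length reduces_length unfolding cyc_reduces_def by fastforce
  qed simp
qed

section \<open>Free cancellation and commutators as cyclic rewriting\<close>

lemma cyc_eq_imp_conj_eq: "u \<approx> v \<Longrightarrow> u \<simeq> v"
  unfolding cyc_reduces_def by (intro r_into_equivclp) blast

lemma reduces_imp_conj_eq: "reduces u v \<Longrightarrow> u \<simeq> v"
  by (intro r_into_equivclp) (auto simp: cyc_reduces_def)

lemma conj_eq_rotate: "u @ v \<simeq> v @ u"
  by (intro cyc_eq_imp_conj_eq r_into_rtranclp rot)

lemma conj_eq_cancel: "u @ x # bar x # v \<simeq> u @ v"
proof -
  have "reduces (u @ x # bar x # v) (v @ u)"
    using reducesI_rotation[of "x # bar x # v" u x "[]" "v @ u"] by simp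
  from reduces_imp_conj_eq[OF this] conj_eq_rotate show ?thesis by (rule equivclp_trans)
qed

text \<open>Swapping the two middle letters leaves two adjacent cancelling pairs.\<close>

lemma conj_eq_commutator:
  assumes "I x y"
  shows "u @ [x, y, bar x, bar y] @ v \<simeq> u @ v"
proof -
  have "u @ [x, y, bar x, bar y] @ v \<simeq> u @ x # bar x # y # bar y # v"
    using swap[of y "bar x" "u @ [x]" "bar y # v"] I_sym[OF assms]
    by (intro cyc_eq_imp_conj_eq) auto
  from equivclp_trans[OF this conj_eq_cancel] conj_eq_cancel show ?thesis by (rule equivclp_trans)
qed

end

subsection \<open>Words in groups and presentations\<close>

context group
begin

lemma word_val_Nil [simp]: "word_val G [] = \<one>"
  and word_val_Cons [simp]: "word_val G (x # w) = x \<otimes> word_val G w"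
  by (simp_all add: word_val_def)

lemma word_val_closed [simp]: "set w \<subseteq> carrier G \<Longrightarrow> word_val G w \<in> carrier G"
  by (induction w) auto

lemma word_val_append:
  "set u \<subseteq> carrier G \<Longrightarrow> set v \<subseteq> carrier G \<Longrightarrow> word_val G (u @ v) = word_val G u \<otimes> word_val G v"
  by (induction u) (auto simp: m_assoc)

lemma word_val_commute:
  "x \<in> carrier G \<Longrightarrow> set u \<subseteq> carrier G \<Longrightarrow> \<forall>y\<in>set u. x \<otimes> y = y \<otimes> x
    \<Longrightarrow> x \<otimes> word_val G u = word_val G u \<otimes> x"
proof (induction u)
  case (Cons y u)
  then have *: "y \<in> carrier G" "word_val G u \<in> carrier G" "x \<otimes> y = y \<otimes> x"
    "x \<otimes> word_val G u = word_val G u \<otimes> x" by auto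
  have "x \<otimes> (y \<otimes> word_val G u) = y \<otimes> (x \<otimes> word_val G u)"
    using m_assoc[OF Cons.prems(1) *(1,2)] m_assoc[OF *(1) Cons.prems(1) *(2)] *(3) by simp
  also have "\<dots> = y \<otimes> word_val G u \<otimes> x"
    unfolding *(4) by (rule m_assoc[OF *(1,2) Cons.prems(1), symmetric])
  finally show ?case by simp
qed simp

lemma commute_inv:
  assumes "x \<in> carrier G" "y \<in> carrier G" "x \<otimes> y = y \<otimes> x"
  shows "inv x \<otimes> y = y \<otimes> inv x"
proof -
  have "inv x \<otimes> y = inv x \<otimes> (y \<otimes> x) \<otimes> inv x"
    using assms(1,2) by (simp add: m_assoc)
  also have "\<dots> = y \<otimes> inv x"
    unfolding assms(3)[symmetric] using assms(1,2) by (simp add: m_assoc[symmetric])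
  finally show ?thesis .
qed

lemma commute_if_commutator:
  assumes "x \<in> carrier G" "y \<in> carrier G" "x \<otimes> (y \<otimes> (inv x \<otimes> inv y)) = \<one>"
  shows "x \<otimes> y = y \<otimes> x"
proof -
  have "x \<otimes> y \<otimes> inv (y \<otimes> x) = \<one>"
    using assms by (simp add: inv_mult_group m_assoc)
  then show ?thesis using assms(1,2) inv_equality inv_inv inv_closed m_closed by metis
qed

lemma conjugate_in_rotation:
  assumes "set w \<subseteq> carrier G"
  shows "conjugate_in G (word_val G w) (word_val G (rotate n w))"
proof -
  let ?u = "take (n mod length w) w" and ?v = "drop (n mod length w) w"
  have c: "set ?u \<subseteq> carrier G" "set ?v \<subseteq> carrier G"
    using assms set_take_subset set_drop_subset by fastforce+
  \<comment> \<open>The conjugator is the inverse of the prefix that the rotation moves to the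
    end.\<close>
  have "word_val G (rotate n w) = inv (word_val G ?u) \<otimes> word_val G (?u @ ?v) \<otimes> inv (inv (word_val G ?u))"
    using c word_val_append[OF c] word_val_append[OF c(2,1)]
    by (simp add: rotate_drop_take m_assoc[symmetric] del: append_take_drop_id)
  then show ?thesis unfolding conjugate_in_def using c(1) by (metis append_take_drop_id inv_closed word_val_closed)
qed

lemma elt_length_le: "w \<in> lists X \<Longrightarrow> elt_length G X (word_val G w) \<le> length w"
  unfolding elt_length_def by (rule Least_le) blast

lemma elt_length_attained:
  assumes "w \<in> lists X"
  shows "\<exists>u\<in>lists X. word_val G u = word_val G w \<and> length u = elt_length G X (word_val G w)"
  unfolding elt_length_def by (rule LeastI) (use assms in blast)

lemma conj_length_le: "conjugate_in G g h \<Longrightarrow> conj_length G X g \<le> elt_length G X h"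
  unfolding conj_length_def by (rule Least_le) blast

lemma conj_length_attained:
  assumes "g \<in> carrier G"
  shows "\<exists>h. conjugate_in G g h \<and> elt_length G X h = conj_length G X g"
proof -
  have "conjugate_in G g g" unfolding conjugate_in_def using assms by (auto intro!: bexI[of _ \<one>])
  then show ?thesis unfolding conj_length_def by (intro LeastI) blast
qed

text \<open>All rotations have the length of \<open>w\<close> and represent conjugates, none of
  which can be shorter than the conjugacy length.\<close>

lemma ConjGeo_subset_CycGeo:
  assumes "X \<subseteq> carrier G"
  shows "ConjGeo G X \<subseteq> CycGeo G X"
proof
  fix w assume "w \<in> ConjGeo G X"
  then have w: "w \<in> lists X" "length w = conj_length G X (word_val G w)"
    unfolding ConjGeo_def conj_geodesic_def by auto
  have "geodesic G X (rotate n w)" for n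
  proof -
    have "conjugate_in G (word_val G w) (word_val G (rotate n w))"
      using w(1) assms by (intro conjugate_in_rotation) auto
    then have "length (rotate n w) \<le> elt_length G X (word_val G (rotate n w))"
      using conj_length_le w(2) by simp
    moreover have "rotate n w \<in> lists X" using w(1) by (auto simp: in_lists_conv_set)
    ultimately show ?thesis using elt_length_le unfolding geodesic_def by (metis antisym)
  qed
  then show "w \<in> CycGeo G X" unfolding CycGeo_def using w(1) by simp
qed

end

section \<open>Evaluation of signed words in a presented group\<close>

fun signed_gen :: "('g, 'm) monoid_scheme \<Rightarrow> ('s \<Rightarrow> 'g) \<Rightarrow> 's \<times> bool \<Rightarrow> 'g" where
  "signed_gen G a (s, b) = (if b then a s else m_inv G (a s))"

locale presentation =
  fixes G :: "('g, 'm) monoid_scheme" (structure) and S :: "'s set" and R a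
  assumes presentation: "has_presentation G S R a"
begin

sublocale group G
  using presentation by (simp add: has_presentation_def)

abbreviation val :: "'s sword \<Rightarrow> 'g" where
  "val U \<equiv> word_val G (map (signed_gen G a) U)"

text \<open>The presentation prescribes \<open>\<phi>\<close> on positive letters only. Free
  cancellation forces its values on inverse letters, and multiplicativity those on all
  words.\<close>

lemma presentation_iso:
  obtains \<phi> where "\<phi> \<in> iso (presented_group S R) G"
    "\<And>U. U \<in> swords S \<Longrightarrow> \<phi> (pres_rel S R `` {U}) = val U"
    "\<And>s. s \<in> S \<Longrightarrow> a s \<in> carrier G"
proof -
  let ?P = "presented_group S R" and ?c = "\<lambda>u. pres_rel S R `` {u}"
  obtain \<phi> where \<phi>: "\<phi> \<in> iso ?P G" "\<And>s. s \<in> S \<Longrightarrow> \<phi> (pres_gen S R s) = a s"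
    using presentation by (auto simp: has_presentation_def)
  interpret \<phi>: group_hom ?P G \<phi>
    using \<phi>(1) group_presented_group is_group
    by (auto simp: group_hom_def group_hom_axioms_def iso_def)
  have inc: "?c U \<in> carrier ?P" if "U \<in> swords S" for U
    using that by (simp add: presented_group_def quotientI)
  have one: "\<phi> (?c []) = \<one>"
    using \<phi>.hom_one by (simp add: presented_group_def)
  have gen: "\<phi> (?c [(s, True)]) = a s" if "s \<in> S" for s
    using \<phi>(2)[OF that] by (simp add: pres_gen_def)
  have closed: "a s \<in> carrier G" if "s \<in> S" for s
    using gen[OF that] inc[of "[(s, True)]"] \<phi>.hom_closed that by (metis SigmaI UNIV_I lists.simps)
  have inverse: "\<phi> (?c [(s, False)]) = inv (a s)" if "s \<in> S" for s
  proof -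
    have s: "[(s, True)] \<in> swords S" "[(s, False)] \<in> swords S" using that by auto
    have "?c ([(s, False)] @ [(s, True)]) = ?c []"
      using pres_rel.cancel[of "[]" S "[]" s False R] that by (intro equiv_class_eq[OF equiv_pres_rel]) auto
    then have "\<phi> (?c [(s, False)]) \<otimes> \<phi> (?c [(s, True)]) = \<one>"
      using pres_mult_class[OF s(2,1), of R] one inc[OF s(1)] inc[OF s(2)] \<phi>.hom_mult by metis
    then show ?thesis using gen[OF that] inc[OF s(2)] closed[OF that] inv_equality by simp
  qed
  have "\<phi> (?c U) = val U" if "U \<in> swords S" for U
    using that
  proof (induction U)
    case Nil
    then show ?case using one by simp
  next
    case (Cons x U)
    obtain s b where x: "x = (s, b)" by (cases x)
    then have sw: "[x] \<in> swords S" "U \<in> swords S" "s \<in> S" using Cons.hyps by auto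
    have "\<phi> (?c (x # U)) = \<phi> (?c [x]) \<otimes> \<phi> (?c U)"
      using pres_mult_class[OF sw(1,2), of R] \<phi>.hom_mult[OF inc[OF sw(1)] inc[OF sw(2)]] by simp
    then show ?case using Cons.IH sw gen inverse x by (cases b) auto
  qed
  then show thesis using that \<phi>(1) closed by blast
qed

lemma gen_closed: "s \<in> S \<Longrightarrow> a s \<in> carrier G"
  using presentation_iso by metis

lemma signed_gen_closed: "signed_gen G a ` (S \<times> UNIV) \<subseteq> carrier G"
  using gen_closed by auto

lemma set_signed_gen: "U \<in> swords S \<Longrightarrow> set (map (signed_gen G a) U) \<subseteq> carrier G"
  using signed_gen_closed by (auto simp: in_lists_conv_set)

lemma val_append: "U \<in> swords S \<Longrightarrow> W \<in> swords S \<Longrightarrow> val (U @ W) = val U \<otimes> val W"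
  by (simp add: word_val_append[OF set_signed_gen set_signed_gen])

text \<open>Injectivity of the isomorphism turns equations in \<open>G\<close> into derivations,
  over which induction is possible.\<close>

lemma val_eq_iff:
  assumes "U \<in> swords S" "W \<in> swords S"
  shows "val U = val W \<longleftrightarrow> (U, W) \<in> pres_rel S R"
proof -
  obtain \<phi> where \<phi>: "\<phi> \<in> iso (presented_group S R) G"
    "\<And>U. U \<in> swords S \<Longrightarrow> \<phi> (pres_rel S R `` {U}) = val U"
    by (rule presentation_iso) (rule that)
  have "inj_on \<phi> (swords S // pres_rel S R)"
    using \<phi>(1) by (simp add: iso_def bij_betw_def presented_group_def)
  then have "val U = val W \<longleftrightarrow> pres_rel S R `` {U} = pres_rel S R `` {W}"
    using inj_on_eq_iff[OF _ quotientI[OF assms(1)] quotientI[OF assms(2)], of \<phi> "pres_rel S R"]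
    by (simp add: \<phi>(2) assms)
  then show ?thesis using eq_equiv_class_iff[OF equiv_pres_rel assms] by simp
qed

lemma val_surj:
  assumes "x \<in> carrier G"
  shows "\<exists>U\<in>swords S. x = val U"
proof -
  obtain \<phi> where \<phi>: "\<phi> \<in> iso (presented_group S R) G"
    "\<And>U. U \<in> swords S \<Longrightarrow> \<phi> (pres_rel S R `` {U}) = val U"
    by (rule presentation_iso) (rule that)
  have "\<phi> ` (swords S // pres_rel S R) = carrier G"
    using \<phi>(1) by (simp add: iso_def bij_betw_def presented_group_def)
  then have "x \<in> \<phi> ` (swords S // pres_rel S R)" using assms by simp
  then obtain Q where Q: "Q \<in> swords S // pres_rel S R" "x = \<phi> Q" by (rule imageE)
  obtain U where "U \<in> swords S" "Q = pres_rel S R `` {U}" using Q(1) by (rule quotientE)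
  then show ?thesis using \<phi>(2) Q(2) by (intro bexI[of _ U]) simp_all
qed

lemma lists_signed_gen:
  "w \<in> lists (signed_gen G a ` (S \<times> UNIV)) \<Longrightarrow> \<exists>U\<in>swords S. w = map (signed_gen G a) U"
  unfolding lists_image by blast

lemma relator_val:
  assumes "r \<in> R" "r \<in> swords S"
  shows "val r = \<one>"
proof -
  have "(r, []) \<in> pres_rel S R" using pres_rel.relator[of "[]" S "[]" r R] assms by simp
  then have "val r = val []" using val_eq_iff[OF assms(2)] by blast
  then show ?thesis by simp
qed

lemma gens_commute:
  assumes "commutators E \<subseteq> R" "(s, t) \<in> E" "s \<in> S" "t \<in> S"
  shows "signed_gen G a (s, b) \<otimes> signed_gen G a (t, c) = signed_gen G a (t, c) \<otimes> signed_gen G a (s, b)"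
proof -
  note cl [simp] = gen_closed[OF assms(3)] gen_closed[OF assms(4)]
  have "[(s, True), (t, True), (s, False), (t, False)] \<in> R"
    using assms(1,2) by (auto simp: commutators_def)
  then have "a s \<otimes> (a t \<otimes> (inv a s \<otimes> inv a t)) = \<one>"
    using relator_val[of "[(s, True), (t, True), (s, False), (t, False)]"] assms(3,4) by simp
  then have 1: "a s \<otimes> a t = a t \<otimes> a s" by (rule commute_if_commutator[OF cl])
  then have 2: "inv a s \<otimes> a t = a t \<otimes> inv a s" by (rule commute_inv[OF cl])
  have "inv a t \<otimes> a s = a s \<otimes> inv a t" using commute_inv[OF cl(2,1) 1[symmetric]] .
  moreover have "inv a t \<otimes> inv a s = inv a s \<otimes> inv a t" using commute_inv[OF cl(2) inv_closed[OF cl(1)] 2[symmetric]] .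
  ultimately show ?thesis using 1 2 by simp
qed

end

section \<open>From conjugacy in the group to cyclic words\<close>

text \<open>
  The map \<open>g\<close> is the identity for Artin groups, and forgets the sign for Coxeter groups, where \<open>bar\<close>
  is the identity.
\<close>

locale commuting_presentation = presentation G S R a + commuting_letters bar I
  for G :: "('g, 'm) monoid_scheme" (structure) and S :: "'s set" and R a
    and bar :: "'l \<Rightarrow> 'l" and I +
  fixes g :: "'s \<times> bool \<Rightarrow> 'l"
  assumes g_Not: "g (s, \<not> b) = bar (g (s, b))"
    and g_relator: "r \<in> R \<Longrightarrow> map g (u @ r @ v) \<simeq> map g (u @ v)"
    and g_commute: "\<lbrakk>k \<in> S \<times> UNIV; l \<in> S \<times> UNIV; I (g k) (g l)\<rbrakk>
      \<Longrightarrow> signed_gen G a k \<otimes> signed_gen G a l = signed_gen G a l \<otimes> signed_gen G a k"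
    and g_cancel: "\<lbrakk>k \<in> S \<times> UNIV; l \<in> S \<times> UNIV; g l = bar (g k)\<rbrakk>
      \<Longrightarrow> signed_gen G a k \<otimes> signed_gen G a l = \<one>"
begin

lemma pres_rel_imp_conj_eq: "(U, W) \<in> pres_rel S R \<Longrightarrow> map g U \<simeq> map g W"
proof (induction rule: pres_rel.induct)
  case (sym u v)
  then show ?case by (blast intro: equivclp_sym)
next
  case (trans u v w)
  then show ?case by (blast intro: equivclp_trans)
next
  case (cancel u v s b)
  then show ?case using conj_eq_cancel[of "map g u" "g (s, b)" "map g v"] by (simp add: g_Not)
next
  case (relator u v r)
  then show ?case by (intro g_relator)
qed simp

text \<open>\<open>W\<close> and the conjugate of \<open>U\<close> by a word \<open>C\<close> are
  related by the presentation; a rotation then brings the formal inverse of \<open>C\<close> next to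
  \<open>C\<close>, where both cancel.\<close>

lemma conjugate_imp_conj_eq:
  assumes "U \<in> swords S" "W \<in> swords S" "conjugate_in G (val U) (val W)"
  shows "map g U \<simeq> map g W"
proof -
  let ?inv = "\<lambda>C. map (\<lambda>(s, b). (s, \<not> b)) (rev C)"
  obtain C where C: "C \<in> swords S" "val W = val C \<otimes> val U \<otimes> inv (val C)"
    using assms(3) val_surj unfolding conjugate_in_def by metis
  note cl [simp] = word_val_closed[OF set_signed_gen]
  have C': "?inv C \<in> swords S" using C(1) by auto
  have r: "(?inv C @ C, []) \<in> pres_rel S R" by (rule pres_inverse_word[OF C(1)])
  then have "val (?inv C) \<otimes> val C = \<one>"
    using val_eq_iff[of "?inv C @ C" "[]"] val_append[OF C' C(1)] C(1) C' by simp
  then have "inv (val C) = val (?inv C)" using cl[OF C(1)] cl[OF C'] by (intro inv_equality)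
  then have "val W = val (C @ U @ ?inv C)"
    using C assms(1) C' val_append[OF C(1), of "U @ ?inv C"] val_append[OF assms(1) C']
    by (simp add: m_assoc del: map_map map_append)
  then have "(C @ U @ ?inv C, W) \<in> pres_rel S R"
    using val_eq_iff[of "C @ U @ ?inv C" W] assms(1,2) C(1) C' by auto
  then have 1: "map g (C @ U @ ?inv C) \<simeq> map g W" by (rule pres_rel_imp_conj_eq)
  have "(U @ ?inv C @ C, U) \<in> pres_rel S R"
    using pres_rel_context[OF r assms(1), of "[]"] by simp
  then have "map g (U @ ?inv C @ C) \<simeq> map g U" by (rule pres_rel_imp_conj_eq)
  from equivclp_sym[OF this] have "map g U \<simeq> map g (C @ U @ ?inv C)"
    using conj_eq_rotate[of "map g (U @ ?inv C)" "map g C"] by (auto intro: equivclp_trans)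
  then show ?thesis using 1 by (rule equivclp_trans)
qed

abbreviation X :: "'g set" where
  "X \<equiv> signed_gen G a ` (S \<times> UNIV)"

text \<open>In the rotation that starts with the pair, the first letter commutes through
  \<open>P\<close> and meets its inverse, so the shorter word \<open>P @ Q\<close> has the same
  value.\<close>

lemma CycGeo_irreducible:
  assumes "U \<in> swords S" "map (signed_gen G a) U \<in> CycGeo G X"
  shows "\<not> reduces (map g U) w"
proof
  let ?e = "signed_gen G a"
  assume "reduces (map g U) w"
  \<comment> \<open>The pair is pulled back along \<open>g\<close> to signed letters. When
    \<open>g\<close> forgets signs, \<open>k\<close> and \<open>l\<close> may even have the same
    sign.\<close>
  then obtain n k P l Q where eq: "rotate n U = k # P @ l # Q" "g l = bar (g k)"
    "\<forall>m\<in>set P. I (g k) (g m)"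
    unfolding reduces_def by (auto simp: rotate_map map_eq_Cons_conv map_eq_append_conv)
  have "set (rotate n U) \<subseteq> S \<times> UNIV" using assms(1) by auto
  then have mem: "k \<in> S \<times> UNIV" "l \<in> S \<times> UNIV" "P \<in> swords S" "Q \<in> swords S"
    unfolding eq(1) by auto
  have cl: "?e k \<in> carrier G" "?e l \<in> carrier G" "val P \<in> carrier G" "val Q \<in> carrier G"
    using mem signed_gen_closed word_val_closed[OF set_signed_gen] by blast+
  have "?e k \<otimes> val P = val P \<otimes> ?e k"
    using eq(3) mem g_commute cl(1) set_signed_gen[OF mem(3)]
    by (intro word_val_commute) (auto simp: in_lists_conv_set simp del: signed_gen.simps)
  then have "val (rotate n U) = val P \<otimes> (?e k \<otimes> ?e l) \<otimes> val Q"
    unfolding eq(1) using val_append[of P "l # Q"] mem cl by (simp add: m_assoc[symmetric])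
  also have "\<dots> = val (P @ Q)" using g_cancel[OF mem(1,2) eq(2)] val_append mem cl by simp
  finally have "elt_length G X (val (rotate n U)) \<le> length (P @ Q)"
    using elt_length_le[of "map ?e (P @ Q)" X] mem by (auto simp: in_lists_conv_set)
  also have "\<dots> < length (rotate n U)" unfolding eq(1) by simp
  finally have "\<not> geodesic G X (rotate n (map ?e U))"
    by (simp add: geodesic_def rotate_map)
  then show False using assms(2) by (simp add: CycGeo_def)
qed

lemma ConjGeo_eq_CycGeo: "ConjGeo G X = CycGeo G X"
proof
  show "ConjGeo G X \<subseteq> CycGeo G X" by (rule ConjGeo_subset_CycGeo[OF signed_gen_closed])
  show "CycGeo G X \<subseteq> ConjGeo G X"
  proof
    fix w assume w: "w \<in> CycGeo G X"
    then have "w \<in> lists X" by (simp add: CycGeo_def)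
    then obtain U where U: "U \<in> swords S" "w = map (signed_gen G a) U" using lists_signed_gen by blast
    have cl: "val U \<in> carrier G" using word_val_closed[OF set_signed_gen[OF U(1)]] .
    obtain h where h: "conjugate_in G (val U) h" "elt_length G X h = conj_length G X (val U)"
      using conj_length_attained[OF cl] by blast
    have "h \<in> carrier G" using h(1) cl unfolding conjugate_in_def by auto
    then obtain W where W: "W \<in> swords S" "h = val W" using val_surj by blast
    \<comment> \<open>\<open>elt_length\<close> is a least value; \<open>W\<close> witnesses that
      some word represents \<open>h\<close>, so the minimum is attained.\<close>
    have "map (signed_gen G a) W \<in> lists X" using W(1) unfolding lists_image by (rule imageI)
    from elt_length_attained[OF this] obtain v
      where v: "v \<in> lists X" "word_val G v = h" "length v = conj_length G X (val U)"
      unfolding W(2)[symmetric] h(2) by blast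
    obtain W' where W': "W' \<in> swords S" "v = map (signed_gen G a) W'"
      using lists_signed_gen[OF v(1)] by blast
    have "conjugate_in G (val U) (val W')" using h(1) v(2) W'(2) by simp
    then have "map g U \<simeq> map g W'" by (rule conjugate_imp_conj_eq[OF U(1) W'(1)])
    moreover have "\<not> reduces (map g U) z" for z
      using CycGeo_irreducible[OF U(1)] w unfolding U(2) by blast
    ultimately have "length w \<le> conj_length G X (word_val G w)"
      using irreducible_shortest[of "map g U" "map g W'"] v(3) W'(2) U(2) by simp
    moreover have "conj_length G X (word_val G w) \<le> elt_length G X (word_val G w)"
      \<comment> \<open>Rotation by 0 says that the element is conjugate to itself.\<close>
      using conjugate_in_rotation[OF set_signed_gen[OF U(1)], of 0] unfolding U(2)
      by (intro conj_length_le) simp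
    then have "conj_length G X (word_val G w) \<le> length w"
      using elt_length_le[OF \<open>w \<in> lists X\<close>] by (rule order_trans)
    ultimately show "w \<in> ConjGeo G X"
      using \<open>w \<in> lists X\<close> by (simp add: ConjGeo_def conj_geodesic_def)
  qed
qed

end

subsection \<open>Right-angled Artin and Coxeter groups\<close>

lemma Artin_ConjGeo_eq_CycGeo:
  fixes V :: "'v set"
  assumes "right_angled_Artin G V E a"
  shows "ConjGeo G (Artin_generators G V a) = CycGeo G (Artin_generators G V a)"
proof -
  have graph: "Relation.sym E" "irrefl E"
    using assms by (simp_all add: right_angled_Artin_def finite_simple_graph_def)
  have E: "(x, y) \<in> E \<longleftrightarrow> (y, x) \<in> E" "(x, x) \<notin> E" for x y
    using symD[OF graph(1)] irreflD[OF graph(2)] by blast+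
  have pres: "has_presentation G V (commutators E) a"
    using assms by (simp add: right_angled_Artin_def)
  interpret presentation G V "commutators E" a by unfold_locales (rule pres)
  \<comment> \<open>Independence looks at the vertices alone, so irreflexivity of \<open>E\<close>
    makes a letter dependent on both itself and its inverse.\<close>
  interpret commuting_letters "\<lambda>(s, b). (s, \<not> b)" "\<lambda>k l. (fst k, fst l) \<in> E"
    by unfold_locales (auto simp: E)
  interpret commuting_presentation G V "commutators E" a
    "\<lambda>(s, b). (s, \<not> b)" "\<lambda>k l. (fst k, fst l) \<in> E" id
  proof
    show "conj_eq (map id (u @ r @ v)) (map id (u @ v))" if r: "r \<in> commutators E" for r u v
    proof -
      obtain s t where "(s, t) \<in> E" "r = [(s, True), (t, True), (s, False), (t, False)]"
        using r by (auto simp: commutators_def)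
      then show ?thesis using conj_eq_commutator[of "(s, True)" "(t, True)" u v] by simp
    qed
  next
    fix k l :: "'v \<times> bool"
    assume "k \<in> V \<times> UNIV" "l \<in> V \<times> UNIV" "(fst (id k), fst (id l)) \<in> E"
    then show "signed_gen G a k \<otimes>\<^bsub>G\<^esub> signed_gen G a l = signed_gen G a l \<otimes>\<^bsub>G\<^esub> signed_gen G a k"
      using gens_commute[OF subset_refl] by (cases k; cases l) (simp del: signed_gen.simps)
  next
    fix k l :: "'v \<times> bool"
    assume "k \<in> V \<times> UNIV" "l \<in> V \<times> UNIV" "id l = (case id k of (s, b) \<Rightarrow> (s, \<not> b))"
    then show "signed_gen G a k \<otimes>\<^bsub>G\<^esub> signed_gen G a l = \<one>\<^bsub>G\<^esub>"
      using gen_closed by (cases k) auto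
  qed simp
  have "X = Artin_generators G V a"
    unfolding Artin_generators_def
  proof (intro equalityI subsetI)
    fix x assume "x \<in> a ` V \<union> m_inv G ` a ` V"
    then consider s where "s \<in> V" "x = signed_gen G a (s, True)"
      | s where "s \<in> V" "x = signed_gen G a (s, False)" by auto
    then show "x \<in> X" by cases blast+
  qed auto
  then show ?thesis using ConjGeo_eq_CycGeo by simp
qed

lemma Coxeter_ConjGeo_eq_CycGeo:
  fixes V :: "'v set"
  assumes "right_angled_Coxeter G V E a"
  shows "ConjGeo G (Coxeter_generators V a) = CycGeo G (Coxeter_generators V a)"
proof -
  have graph: "Relation.sym E" "irrefl E"
    using assms by (simp_all add: right_angled_Coxeter_def finite_simple_graph_def)
  have E: "(x, y) \<in> E \<longleftrightarrow> (y, x) \<in> E" "(x, x) \<notin> E" for x y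
    using symD[OF graph(1)] irreflD[OF graph(2)] by blast+
  have pres: "has_presentation G V (squares V \<union> commutators E) a"
    using assms by (simp add: right_angled_Coxeter_def)
  interpret presentation G V "squares V \<union> commutators E" a by unfold_locales (rule pres)
  have sq: "a s \<otimes>\<^bsub>G\<^esub> a s = \<one>\<^bsub>G\<^esub>" if "s \<in> V" for s
  proof -
    have "[(s, True), (s, True)] \<in> squares V" using that by (auto simp: squares_def)
    then have "val [(s, True), (s, True)] = \<one>\<^bsub>G\<^esub>" using that by (intro relator_val) auto
    then show ?thesis using gen_closed[OF that] by simp
  qed
  \<comment> \<open>The square relators make each generator its own inverse, so the sign does not
    affect the value.\<close>
  have gen: "signed_gen G a k = a (fst k)" if k: "k \<in> V \<times> UNIV" for k
  proof -
    obtain s b where "k = (s, b)" "s \<in> V" using k by (cases k) auto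
    then show ?thesis
      using inv_equality[OF sq gen_closed gen_closed] by simp
  qed
  \<comment> \<open>With \<open>bar\<close> the identity, a cancelling pair is two occurrences of
    the same vertex.\<close>
  interpret commuting_letters id "\<lambda>s t. (s, t) \<in> E"
    by unfold_locales (auto simp: E)
  interpret commuting_presentation G V "squares V \<union> commutators E" a id "\<lambda>s t. (s, t) \<in> E" fst
  proof
    show "conj_eq (map fst (u @ r @ v)) (map fst (u @ v))" if r: "r \<in> squares V \<union> commutators E" for r u v
    proof -
      consider s where "r = [(s, True), (s, True)]"
        | s t where "(s, t) \<in> E" "r = [(s, True), (t, True), (s, False), (t, False)]"
        using r by (auto simp: commutators_def squares_def)
      then show ?thesis
      proof cases
        case 1
        then show ?thesis using conj_eq_cancel[of "map fst u" s "map fst v"] by simp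
      next
        case 2
        then show ?thesis using conj_eq_commutator[of s t "map fst u" "map fst v"] by simp
      qed
    qed
  next
    fix k l :: "'v \<times> bool"
    assume "k \<in> V \<times> UNIV" "l \<in> V \<times> UNIV" "(fst k, fst l) \<in> E"
    then show "signed_gen G a k \<otimes>\<^bsub>G\<^esub> signed_gen G a l = signed_gen G a l \<otimes>\<^bsub>G\<^esub> signed_gen G a k"
      using gens_commute[of E "fst k" "fst l" "snd k" "snd l"] by (simp add: mem_Times_iff)
  next
    fix k l :: "'v \<times> bool"
    assume "k \<in> V \<times> UNIV" "l \<in> V \<times> UNIV" "fst l = id (fst k)"
    then show "signed_gen G a k \<otimes>\<^bsub>G\<^esub> signed_gen G a l = \<one>\<^bsub>G\<^esub>"
      using gen[of k] gen[of l] sq[of "fst k"] mem_Times_iff id_apply by metis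
  qed simp
  have "signed_gen G a ` (V \<times> UNIV) = (\<lambda>k. a (fst k)) ` (V \<times> (UNIV :: bool set))"
    by (rule image_cong) (rule HOL.refl, rule gen)
  also have "\<dots> = a ` fst ` (V \<times> (UNIV :: bool set))" by (rule image_image[symmetric])
  also have "fst ` (V \<times> (UNIV :: bool set)) = V" by simp
  finally show ?thesis using ConjGeo_eq_CycGeo by (simp add: Coxeter_generators_def)
qed

theorem corollary2p5:
  fixes G :: "('g, 'm) monoid_scheme"
    and V :: "'v set" and E :: "'v rel" and a :: "'v \<Rightarrow> 'g"
  shows "(right_angled_Artin G V E a \<longrightarrow>
            ConjGeo G (Artin_generators G V a) = CycGeo G (Artin_generators G V a)) \<and>
         (right_angled_Coxeter G V E a \<longrightarrow>
            ConjGeo G (Coxeter_generators V a) = CycGeo G (Coxeter_generators V a))"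
  using Artin_ConjGeo_eq_CycGeo Coxeter_ConjGeo_eq_CycGeo by blast

end
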